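(* Let the polynomials $\psi_\nu$ ($\nu \geq 1$) be defined by the recurrence described in the context. Then: (1) for every $\nu \geq 1$, $\psi_\nu \in \mathbb{Z}[x_1,\ldots,x_\nu]$ and $\psi_\nu$ has no constant term; (2) for every integer $n \geq 1$ and every odd prime $p > n$, \[ W_p \equiv \sum_{\nu=1}^{n} \frac{p^{\nu-1}}{\nu!}\, \psi_\nu\bigl(Q_p(1),\ldots,Q_p(\nu)\bigr) \pmod{p^n}, \] and equivalently \[ (p-1)! \equiv -1 + \sum_{\nu=1}^{n} \frac{p^{\nu}}{\nu!}\, \psi_\nu\bigl(Q_p(1),\ldots,Q_p(\nu)\bigr) \pmod{p^{n+1}}. \] (The congruences are among rationals whose denominators are prime to $p$.)
   Context: For an odd prime $p$, the Wilson quotient is $W_p = ((p-1)!+1)/p$, the Fermat quotient of an integer $a$ coprime to $p$ is $q_p(a) = (a^{p-1}-1)/p$, and $Q_p(n) = \sum_{a=1}^{p-1} q_p(a)^n$ for $n \geq 1$. Partial Bell polynomials: for $n \geq 1$, $1 \leq k \leq n$, \[ B_{n,k}(y_1,\ldots,y_{n-k+1}) = \sum \frac{n!}{j_1!\cdots j_{n-k+1}!}\prod_{i=1}^{n-k+1}\Bigl(\frac{y_i}{i!}\Bigr)^{j_i}, \] the sum over nonnegative integers $j_1,\ldots,j_{n-k+1}$ with $\sum_i i j_i = n$ and $\sum_i j_i = k$; complete Bell polynomials $B_n = \sum_{k=1}^n B_{n,k}$. Stirling numbers of the first kind $S_1(n,k)$ are defined by $(x)_n = x(x-1)\cdots(x-n+1)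 = \sum_{k} S_1(n,k)x^k$, and $(n)_k = n!/(n-k)!$. Put $\sigma^\star_n = (-1)^n B_n(-x_1, -1!\,x_2, -2!\,x_3, \ldots, -(n-1)!\,x_n)$. Define $\psi_0 = 0$ and for $n \geq 1$ \[ \psi_n = n\,\psi_{n-1} + \sigma^\star_n + \Psi_n,\qquad \Psi_n = \sum_{\nu=2}^{n}\sum_{k=0}^{\min(\nu,n-\nu)} (-1)^{\nu+1} S_1(\nu+1,k+1)\,(n)_k\, B_{n-k,\nu}(\psi_1,\ldots,\psi_{n-k-\nu+1}) \] (so $\Psi_1 = 0$, $\psi_1 = x_1$, and $\Psi_n$ involves only $\psi_1,\ldots,\psi_{n-1}$). For example $\psi_2 = 2x_1 - x_1^2 - x_2$. *)

theory Defs
  imports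
    "HOL-Library.Poly_Mapping"
    "HOL-Library.FuncSet"
    "HOL-Computational_Algebra.Polynomial"
    "HOL-Computational_Algebra.Primes"
begin

text \<open>
  Polynomials over the rationals in indeterminates \<open>x\<^sub>i\<close>: exponent vectors are finitely supported maps \<^typ>\<open>nat \<Rightarrow>\<^sub>0 nat\<close>; the ring structure (convolution
  product) is the one of \<^theory>\<open>HOL-Library.Poly_Mapping\<close>.
\<close>

type_synonym qpoly = "(nat \<Rightarrow>\<^sub>0 nat) \<Rightarrow>\<^sub>0 rat"

definition qconst :: "rat \<Rightarrow> qpoly" where
  "qconst c = Poly_Mapping.single 0 c"

definition qvar :: "nat \<Rightarrow> qpoly" where
  "qvar i = Poly_Mapping.single (Poly_Mapping.single i 1) 1"

definition qeval :: "qpoly \<Rightarrow> (nat \<Rightarrow> rat) \<Rightarrow> rat" where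
  "qeval P a = (\<Sum>m\<in>Poly_Mapping.keys P.
     Poly_Mapping.lookup P m * (\<Prod>i\<in>Poly_Mapping.keys m. a i ^ Poly_Mapping.lookup m i))"

definition bell_index :: "nat \<Rightarrow> nat \<Rightarrow> (nat \<Rightarrow> nat) set" where
  "bell_index n k = {j \<in> {1..n-k+1} \<rightarrow>\<^sub>E UNIV.
     (\<Sum>i=1..n-k+1. i * j i) = n \<and> (\<Sum>i=1..n-k+1. j i) = k}"

lemma finite_bell_index: "finite (bell_index n k)"
proof (rule finite_subset)
  show "bell_index n k \<subseteq> {1..n-k+1} \<rightarrow>\<^sub>E {..k}"
  proof
    fix j assume j: "j \<in> bell_index n k"
    have "j i \<le> k" if "i \<in> {1..n-k+1}" for i
    proof -
      have "j i \<le> (\<Sum>i=1..n-k+1. j i)"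
        using that by (intro member_le_sum) auto
      with j show ?thesis by (simp add: bell_index_def)
    qed
    with j show "j \<in> {1..n-k+1} \<rightarrow>\<^sub>E {..k}"
      by (auto simp: bell_index_def PiE_iff)
  qed
qed (auto intro: finite_PiE)

definition partial_bell :: "nat \<Rightarrow> nat \<Rightarrow> (nat \<Rightarrow> qpoly) \<Rightarrow> qpoly" where
  "partial_bell n k y = (\<Sum>j\<in>bell_index n k.
     qconst (fact n / (\<Prod>i=1..n-k+1. fact (j i))) *
     (\<Prod>i=1..n-k+1. (qconst (1 / fact i) * y i) ^ j i))"

definition complete_bell :: "nat \<Rightarrow> (nat \<Rightarrow> qpoly) \<Rightarrow> qpoly" where
  "complete_bell n y = (\<Sum>k=1..n. partial_bell n k y)"

definition stirling1 :: "nat \<Rightarrow> nat \<Rightarrow> int" where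
  "stirling1 n k = poly.coeff (\<Prod>i<n. [:- int i, 1:]) k"

definition sigma_star :: "nat \<Rightarrow> qpoly" where
  "sigma_star n = (-1) ^ n * complete_bell n (\<lambda>i. - (qconst (fact (i - 1)) * qvar i))"

definition big_psi :: "nat \<Rightarrow> (nat \<Rightarrow> qpoly) \<Rightarrow> qpoly" where
  "big_psi n y = (\<Sum>\<nu>=2..n. \<Sum>k=0..min \<nu> (n-\<nu>).
     qconst ((-1) ^ (\<nu>+1) * of_int (stirling1 (\<nu>+1) (k+1)) * (fact n / fact (n-k))) *
     partial_bell (n-k) \<nu> y)"

text \<open>
  The guard \<open>i \<le> n\<close> only makes the recursion well-founded: \<open>big_psi (Suc n)\<close> uses its second
  argument only at indices \<open>1, \<dots>, n\<close>. Lemma \<open>psi_rec\<close> below is the recurrence without it.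
\<close>

fun psi :: "nat \<Rightarrow> qpoly" where
  "psi 0 = 0"
| "psi (Suc n) = of_nat (Suc n) * psi n + sigma_star (Suc n)
     + big_psi (Suc n) (\<lambda>i. if i \<le> n then psi i else 0)"

lemma partial_bell_cong:
  assumes "\<And>i. 1 \<le> i \<Longrightarrow> i \<le> n - k + 1 \<Longrightarrow> y i = z i"
  shows "partial_bell n k y = partial_bell n k z"
  unfolding partial_bell_def
  by (intro sum.cong refl arg_cong2[where f = "(*)"] prod.cong) (use assms in auto)

lemma big_psi_cong:
  assumes "\<And>i. 1 \<le> i \<Longrightarrow> i < n \<Longrightarrow> y i = z i"
  shows "big_psi n y = big_psi n z"
  unfolding big_psi_def
  by (intro sum.cong refl arg_cong2[where f = "(*)"] partial_bell_cong assms) auto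

lemma psi_rec:
  assumes "n \<ge> 1"
  shows "psi n = of_nat n * psi (n - 1) + sigma_star n + big_psi n psi"
proof -
  obtain m where n: "n = Suc m" using assms by (cases n) auto
  have "big_psi n (\<lambda>i. if i \<le> m then psi i else 0) = big_psi n psi"
    by (rule big_psi_cong) (simp add: n)
  then show ?thesis by (simp add: n)
qed

definition wilson_quotient :: "nat \<Rightarrow> rat" where
  "wilson_quotient p = (fact (p - 1) + 1) / of_nat p"

definition fermat_quotient :: "nat \<Rightarrow> int \<Rightarrow> rat" where
  "fermat_quotient p a = (of_int a ^ (p - 1) - 1) / of_nat p"

definition fermat_sum :: "nat \<Rightarrow> nat \<Rightarrow> rat" where
  "fermat_sum p n = (\<Sum>a=1..p-1. fermat_quotient p (int a) ^ n)"

text \<open>\<open>p_integral p\<close> is meant for prime \<open>p\<close>: membership in the localization of the integers at \<open>p\<close>.\<close>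

definition p_integral :: "nat \<Rightarrow> rat \<Rightarrow> bool" where
  "p_integral p r \<longleftrightarrow> coprime (snd (quotient_of r)) (int p)"

definition rat_cong :: "nat \<Rightarrow> nat \<Rightarrow> rat \<Rightarrow> rat \<Rightarrow> bool" where
  "rat_cong p n a b \<longleftrightarrow> p_integral p a \<and> p_integral p b \<and>
     (\<exists>c. p_integral p c \<and> a - b = of_nat p ^ n * c)"

end

theory Submission
  imports Defs "HOL-Number_Theory.Residues" "HOL-Computational_Algebra.Polynomial_FPS"
begin

text \<open>
  Since \<open>a\<^bsup>p-1\<^esup> = 1 + p q\<^sub>p(a)\<close> and \<open>(p-1)! = p W\<^sub>p - 1\<close>, raising \<open>(p-1)!\<close> to the even power \<open>p - 1\<close> gives
  \<open>(1 - p W\<^sub>p)\<^bsup>p-1\<^esup> = \<Prod>\<^sub>a (1 + p q\<^sub>p(a))\<close>. The recurrence for \<open>\<psi>\<^sub>\<nu>\<close> says precisely that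
  \<open>F(t) = \<Sum>\<^sub>\<nu> \<psi>\<^sub>\<nu> t\<^sup>\<nu> / \<nu>!\<close> solves \<open>(1 - F(t))\<^bsup>t-1\<^esup> = \<Prod>\<^sub>a (1 + q\<^sub>p(a) t)\<close> as formal power series: the
  Stirling numbers are the coefficients of \<open>\<nu>!\<close> times the binomial coefficient \<open>t - 1\<close> over \<open>\<nu>\<close>, the
  partial Bell polynomials are those of \<open>F(t)\<^sup>\<nu> / \<nu>!\<close>, and \<open>\<sigma>\<^sup>\<star>\<^sub>n / n!\<close> is the \<open>n\<close>-th elementary symmetric
  function in terms of power sums. Truncating at order \<open>n < p\<close> keeps all coefficients integral at \<open>p\<close>,
  so with \<open>S = \<Sum>\<^sub>\<nu>\<^sub>\<le>\<^sub>n \<psi>\<^sub>\<nu> p\<^sup>\<nu> / \<nu>!\<close> we get \<open>(1 - S)\<^bsup>p-1\<^esup> \<equiv> (1 - p W\<^sub>p)\<^bsup>p-1\<^esup>\<close> modulo \<open>p\<^bsup>n+1\<^esup>\<close>. Both bases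
  are 1 modulo \<open>p\<close> and \<open>p - 1\<close> is a unit, hence \<open>S \<equiv> p W\<^sub>p\<close> modulo \<open>p\<^bsup>n+1\<^esup>\<close>.
\<close>

unbundle fps_syntax

section \<open>Evaluation of polynomials\<close>

definition mono_eval :: "(nat \<Rightarrow> rat) \<Rightarrow> (nat \<Rightarrow>\<^sub>0 nat) \<Rightarrow> rat" where
  "mono_eval a m = (\<Prod>i\<in>Poly_Mapping.keys m. a i ^ Poly_Mapping.lookup m i)"

lemma mono_eval_superset:
  assumes "finite A" "Poly_Mapping.keys m \<subseteq> A"
  shows "mono_eval a m = (\<Prod>i\<in>A. a i ^ Poly_Mapping.lookup m i)"
  unfolding mono_eval_def
  by (rule prod.mono_neutral_left) (use assms in \<open>auto simp: in_keys_iff\<close>)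

lemma mono_eval_add: "mono_eval a (m + m') = mono_eval a m * mono_eval a m'"
proof -
  let ?A = "Poly_Mapping.keys m \<union> Poly_Mapping.keys m'"
  have "mono_eval a (m + m') = (\<Prod>i\<in>?A. a i ^ Poly_Mapping.lookup (m + m') i)"
    by (rule mono_eval_superset) (auto dest: subsetD[OF Poly_Mapping.keys_add])
  also have "\<dots> = (\<Prod>i\<in>?A. a i ^ Poly_Mapping.lookup m i) * (\<Prod>i\<in>?A. a i ^ Poly_Mapping.lookup m' i)"
    by (simp add: lookup_add power_add prod.distrib)
  also have "\<dots> = mono_eval a m * mono_eval a m'"
    by (simp add: mono_eval_superset[of ?A])
  finally show ?thesis .
qed

lemma qeval_superset:
  assumes "finite A" "Poly_Mapping.keys P \<subseteq> A"
  shows "qeval P a = (\<Sum>m\<in>A. Poly_Mapping.lookup P m * mono_eval a m)"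
  unfolding qeval_def mono_eval_def
  by (rule sum.mono_neutral_left) (use assms in \<open>auto simp: in_keys_iff\<close>)

lemma qeval_add: "qeval (P + Q) a = qeval P a + qeval Q a"
proof -
  let ?A = "Poly_Mapping.keys P \<union> Poly_Mapping.keys Q"
  have "qeval (P + Q) a = (\<Sum>m\<in>?A. Poly_Mapping.lookup (P + Q) m * mono_eval a m)"
    by (rule qeval_superset) (auto dest: subsetD[OF Poly_Mapping.keys_add])
  then show ?thesis
    by (simp add: qeval_superset[of ?A] lookup_add sum.distrib algebra_simps)
qed

lemma qeval_0 [simp]: "qeval 0 a = 0"
  by (simp add: qeval_def)

lemma qeval_uminus: "qeval (- P) a = - qeval P a"
  using qeval_add[of P "- P" a] by simp

lemma qeval_sum: "qeval (sum f A) a = (\<Sum>x\<in>A. qeval (f x) a)"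
  by (induction A rule: infinite_finite_induct) (simp_all add: qeval_add)

lemma qeval_single: "qeval (Poly_Mapping.single m c) a = c * mono_eval a m"
  by (simp add: qeval_def mono_eval_def)

lemma poly_mapping_sum_single:
  "P = (\<Sum>m\<in>Poly_Mapping.keys P. Poly_Mapping.single m (Poly_Mapping.lookup P m))"
  by (rule poly_mapping_eqI) (simp add: lookup_sum lookup_single when_def in_keys_iff)

text \<open>Expanding a product into monomials reduces multiplicativity of evaluation and
  integrality of products to single monomials.\<close>

lemma poly_mapping_mult_sum_single:
  fixes P Q :: "'a::monoid_add \<Rightarrow>\<^sub>0 'b::semiring_0"
  shows "P * Q = (\<Sum>m\<in>Poly_Mapping.keys P. \<Sum>m'\<in>Poly_Mapping.keys Q.
    Poly_Mapping.single (m + m') (Poly_Mapping.lookup P m * Poly_Mapping.lookup Q m'))"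
proof -
  have "P * Q = (\<Sum>m\<in>Poly_Mapping.keys P. Poly_Mapping.single m (Poly_Mapping.lookup P m)) *
      (\<Sum>m\<in>Poly_Mapping.keys Q. Poly_Mapping.single m (Poly_Mapping.lookup Q m))"
    by (simp flip: poly_mapping_sum_single)
  then show ?thesis by (simp add: sum_product mult_single)
qed

lemma qeval_mult: "qeval (P * Q) a = qeval P a * qeval Q a"
  unfolding poly_mapping_mult_sum_single qeval_sum qeval_single mono_eval_add
  by (simp add: qeval_superset[OF finite_keys subset_refl, of P]
      qeval_superset[OF finite_keys subset_refl, of Q] sum_product ac_simps)

lemma qeval_qconst [simp]: "qeval (qconst c) a = c"
  by (simp add: qconst_def qeval_single mono_eval_def)

lemma qconst_1: "qconst 1 = 1"
  by (simp add: qconst_def)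

lemma qconst_mult: "qconst (c * d) = qconst c * qconst d"
  by (simp add: qconst_def mult_single)

lemma qconst_of_int: "qconst (of_int c) = of_int c"
  by (simp add: qconst_def)

lemma qconst_power: "qconst (c ^ n) = qconst c ^ n"
  by (induction n) (simp_all add: qconst_1 qconst_mult)

lemma qconst_prod: "qconst (prod f A) = (\<Prod>x\<in>A. qconst (f x))"
  by (induction A rule: infinite_finite_induct) (simp_all add: qconst_1 qconst_mult)

lemma qeval_of_int [simp]: "qeval (of_int c) a = of_int c"
  by (metis qconst_of_int qeval_qconst)

lemma qeval_of_nat [simp]: "qeval (of_nat c) a = of_nat c"
  by (metis of_int_of_nat_eq qeval_of_int)

lemma qeval_1 [simp]: "qeval 1 a = 1"
  by (metis of_nat_1 qeval_of_nat)

lemma qeval_power: "qeval (P ^ n) a = qeval P a ^ n"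
  by (induction n) (simp_all add: qeval_mult)

lemma qeval_prod: "qeval (prod f A) a = (\<Prod>x\<in>A. qeval (f x) a)"
  by (induction A rule: infinite_finite_induct) (simp_all add: qeval_mult)

lemma qeval_qvar [simp]: "qeval (qvar i) a = a i"
  by (simp add: qvar_def qeval_single mono_eval_def)

text \<open>At the origin every monomial but the empty one has a factor 0; so the constant term can
  be followed through the recurrence by evaluation.\<close>

lemma lookup_0_eq_qeval: "Poly_Mapping.lookup P 0 = qeval P (\<lambda>_. 0)"
proof -
  have *: "mono_eval (\<lambda>_. 0) m = (if m = 0 then 1 else 0)" for m
    by (auto simp: mono_eval_def in_keys_iff poly_mapping_eq_iff fun_eq_iff)
  show ?thesis
    by (simp add: * qeval_superset[OF finite_keys subset_refl] in_keys_iff if_distrib cong: if_cong)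
qed

section \<open>Integrality\<close>

text \<open>The subring Z[x_1,...,x_N] of the rational polynomials.\<close>

definition int_qpoly :: "nat \<Rightarrow> qpoly \<Rightarrow> bool" where
  "int_qpoly N P \<longleftrightarrow> (\<forall>m. Poly_Mapping.lookup P m \<in> \<int>) \<and>
     (\<forall>m\<in>Poly_Mapping.keys P. Poly_Mapping.keys m \<subseteq> {1..N})"

lemma int_qpoly_mono: "int_qpoly N P \<Longrightarrow> N \<le> N' \<Longrightarrow> int_qpoly N' P"
  unfolding int_qpoly_def using atLeastatMost_subset_iff[of 1 N 1 N'] by blast

lemma int_qpoly_0: "int_qpoly N 0"
  by (simp add: int_qpoly_def)

lemma int_qpoly_add: "int_qpoly N P \<Longrightarrow> int_qpoly N Q \<Longrightarrow> int_qpoly N (P + Q)"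
  unfolding int_qpoly_def lookup_add using Poly_Mapping.keys_add[of P Q] by (blast intro: Ints_add)

lemma int_qpoly_uminus: "int_qpoly N P \<Longrightarrow> int_qpoly N (- P)"
  by (simp add: int_qpoly_def in_keys_iff)

lemma int_qpoly_sum: "(\<And>x. x \<in> A \<Longrightarrow> int_qpoly N (f x)) \<Longrightarrow> int_qpoly N (sum f A)"
  by (induction A rule: infinite_finite_induct) (simp_all add: int_qpoly_0 int_qpoly_add)

lemma int_qpoly_single:
  "c \<in> \<int> \<Longrightarrow> Poly_Mapping.keys m \<subseteq> {1..N} \<Longrightarrow> int_qpoly N (Poly_Mapping.single m c)"
  by (auto simp: int_qpoly_def lookup_single when_def in_keys_iff split: if_splits)

lemma int_qpoly_mult:
  assumes "int_qpoly N P" "int_qpoly N Q"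
  shows "int_qpoly N (P * Q)"
  unfolding poly_mapping_mult_sum_single
proof (intro int_qpoly_sum int_qpoly_single Ints_mult)
  fix m m' assume "m \<in> Poly_Mapping.keys P" "m' \<in> Poly_Mapping.keys Q"
  then show "Poly_Mapping.keys (m + m') \<subseteq> {1..N}"
    using assms Poly_Mapping.keys_add[of m m'] unfolding int_qpoly_def by blast
qed (use assms in \<open>auto simp: int_qpoly_def\<close>)

lemma int_qpoly_qconst: "c \<in> \<int> \<Longrightarrow> int_qpoly N (qconst c)"
  by (simp add: qconst_def int_qpoly_single)

lemma int_qpoly_of_nat: "int_qpoly N (of_nat c)"
  using int_qpoly_qconst[of "of_int (int c)" N] unfolding qconst_of_int by simp

lemma int_qpoly_power: "int_qpoly N P \<Longrightarrow> int_qpoly N (P ^ n)"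
  using int_qpoly_of_nat[of N 1] by (induction n) (simp_all add: int_qpoly_mult)

lemma int_qpoly_prod: "(\<And>x. x \<in> A \<Longrightarrow> int_qpoly N (f x)) \<Longrightarrow> int_qpoly N (prod f A)"
  using int_qpoly_of_nat[of N 1]
  by (induction A rule: infinite_finite_induct) (simp_all add: int_qpoly_mult)

lemma int_qpoly_qvar: "1 \<le> i \<Longrightarrow> i \<le> N \<Longrightarrow> int_qpoly N (qvar i)"
  by (simp add: qvar_def int_qpoly_single)

text \<open>The quotient counts the partitions of a set of i*j elements into j blocks of size i; for
  i = 0 this would fail once j >= 2.\<close>

lemma fact_power_mult_fact_dvd:
  assumes "i \<ge> 1"
  shows "fact j * fact i ^ j dvd (fact (i * j) :: nat)"
proof (induction j)
  case (Suc j)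
  obtain i' where i: "i = Suc i'" using assms by (cases i) auto
  \<comment> \<open>Absorption k C(n,k) = n C(n-1,k-1) with n = i(j+1) and k = i, divided by i; it
    supplies the new factor j+1.\<close>
  have "(i * Suc j) choose i = Suc j * ((i * j + i') choose i')"
  proof -
    have "Suc i' * ((i * Suc j) choose Suc i') = Suc i' * (Suc j * ((i * j + i') choose i'))"
      using Suc_times_binomial_eq[of "i * j + i'" i'] by (simp add: i algebra_simps)
    then show ?thesis by (metis i mult_cancel1 nat.distinct(1))
  qed
  moreover have "fact i * fact (i * j) * ((i * Suc j) choose i) = (fact (i * Suc j) :: nat)"
    using binomial_fact_lemma[of i "i * Suc j"] by simp
  ultimately have eq: "fact (i * Suc j) = fact (i * j) * (fact i * (Suc j * ((i * j + i') choose i')))"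
    by (simp add: ac_simps)
  have "fact (Suc j) * fact i ^ Suc j = (fact j * fact i ^ j) * (fact i * Suc j :: nat)"
    by (simp add: algebra_simps)
  also have "\<dots> dvd fact (i * j) * (fact i * Suc j)"
    using Suc by (rule mult_dvd_mono) simp
  also have "\<dots> dvd fact (i * Suc j)"
    unfolding eq by (metis dvd_triv_left mult.assoc)
  finally show ?case .
qed simp

lemma prod_fact_dvd_fact_sum:
  fixes f :: "'a \<Rightarrow> nat"
  shows "(\<Prod>x\<in>A. fact (f x)) dvd (fact (sum f A) :: nat)"
proof (induction A rule: infinite_finite_induct)
  case (insert x A)
  have "fact (f x) * (\<Prod>x\<in>A. fact (f x)) dvd (fact (f x) * fact (sum f A) :: nat)"
    using insert.IH by simp
  also have "\<dots> dvd fact (f x + sum f A)"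
    by (rule fact_fact_dvd_fact)
  finally show ?case using insert by simp
qed auto

text \<open>Cut a set of n elements into chunks of sizes i * j_i, then each chunk into j_i blocks of
  size i; the quotient counts set partitions of type j.\<close>

lemma bell_coefficient_dvd:
  assumes "j \<in> bell_index n k"
  shows "(\<Prod>i=1..n-k+1. fact (j i) * fact i ^ j i) dvd (fact n :: nat)"
proof -
  have "(\<Prod>i=1..n-k+1. fact (j i) * fact i ^ j i) dvd (\<Prod>i=1..n-k+1. fact (i * j i) :: nat)"
    by (rule prod_dvd_prod) (simp add: fact_power_mult_fact_dvd)
  also have "\<dots> dvd fact (\<Sum>i=1..n-k+1. i * j i)"
    by (rule prod_fact_dvd_fact_sum)
  finally show ?thesis using assms by (simp add: bell_index_def)
qed

text \<open>The factors 1/i! are not integral one by one; gathered with the j_i! they give the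
  integer of \<open>bell_coefficient_dvd\<close>.\<close>

lemma partial_bell_altdef:
  "partial_bell n k y = (\<Sum>j\<in>bell_index n k.
     qconst (fact n / (\<Prod>i=1..n-k+1. fact (j i) * fact i ^ j i)) * (\<Prod>i=1..n-k+1. y i ^ j i))"
  unfolding partial_bell_def
proof (rule sum.cong[OF refl])
  fix j
  have "(\<Prod>i=1..n-k+1. (qconst (1 / fact i) * y i) ^ j i) =
      qconst (\<Prod>i=1..n-k+1. (1 / fact i) ^ j i) * (\<Prod>i=1..n-k+1. y i ^ j i)"
    by (simp only: power_mult_distrib prod.distrib qconst_prod qconst_power)
  moreover have "fact n / (\<Prod>i=1..n-k+1. fact (j i) * fact i ^ j i) =
      fact n / (\<Prod>i=1..n-k+1. fact (j i)) * (\<Prod>i=1..n-k+1. (1 / fact i :: rat) ^ j i)"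
    by (simp add: prod.distrib power_one_over prod_dividef)
  ultimately show "qconst (fact n / (\<Prod>i=1..n-k+1. fact (j i))) * (\<Prod>i=1..n-k+1. (qconst (1 / fact i) * y i) ^ j i) =
     qconst (fact n / (\<Prod>i=1..n-k+1. fact (j i) * fact i ^ j i)) * (\<Prod>i=1..n-k+1. y i ^ j i)"
    by (simp only: qconst_mult mult.assoc)
qed

lemma int_qpoly_partial_bell:
  assumes "\<And>i. 1 \<le> i \<Longrightarrow> i \<le> n - k + 1 \<Longrightarrow> int_qpoly N (y i)"
  shows "int_qpoly N (partial_bell n k y)"
  unfolding partial_bell_altdef
proof (intro int_qpoly_sum int_qpoly_mult int_qpoly_prod int_qpoly_power int_qpoly_qconst)
  fix j assume "j \<in> bell_index n k"
  from bell_coefficient_dvd[OF this] obtain c where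
    c: "fact n = (\<Prod>i=1..n-k+1. fact (j i) * fact i ^ j i) * (c :: nat)" by (elim dvdE)
  have "fact n / (\<Prod>i=1..n-k+1. fact (j i) * fact i ^ j i) = (of_nat c :: rat)"
  proof -
    have "(fact n :: rat) = of_nat (\<Prod>i=1..n-k+1. fact (j i) * fact i ^ j i) * of_nat c"
      unfolding of_nat_mult[symmetric] c[symmetric] by simp
    moreover have "(of_nat (\<Prod>i=1..n-k+1. fact (j i) * fact i ^ j i) :: rat) \<noteq> 0"
      by (subst of_nat_eq_0_iff) (auto simp: prod_zero_iff simp del: prod.cl_ivl_Suc)
    moreover have "(\<Prod>i=1..n-k+1. fact (j i) * fact i ^ j i) =
        (of_nat (\<Prod>i=1..n-k+1. fact (j i) * fact i ^ j i) :: rat)"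
      by (simp only: of_nat_prod of_nat_mult of_nat_power of_nat_fact)
    ultimately show ?thesis by (metis nonzero_mult_div_cancel_left)
  qed
  then show "(fact n / (\<Prod>i=1..n-k+1. fact (j i) * fact i ^ j i) :: rat) \<in> \<int>" by simp
qed (use assms in auto)

section \<open>Integrality of the polynomials \<open>psi\<close>\<close>

lemma fact_div_fact_Ints: "k \<le> n \<Longrightarrow> (fact n / fact k :: rat) \<in> \<int>"
  using Ints_of_int[where 'a = rat, of "fact n div fact k"]
  by (simp add: of_int_div fact_dvd)

lemma int_qpoly_sigma_star: "int_qpoly n (sigma_star n)"
proof -
  have "int_qpoly n (complete_bell n (\<lambda>i. - (qconst (fact (i - 1)) * qvar i)))"
    unfolding complete_bell_def
    by (intro int_qpoly_sum int_qpoly_partial_bell int_qpoly_uminus int_qpoly_mult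
        int_qpoly_qconst int_qpoly_qvar) (auto simp: fact_in_Ints)
  moreover have "int_qpoly n ((- 1) ^ n)"
    by (intro int_qpoly_power int_qpoly_uminus) (use int_qpoly_of_nat[of n 1] in simp)
  ultimately show ?thesis unfolding sigma_star_def by (intro int_qpoly_mult)
qed

lemma int_qpoly_psi: "int_qpoly n (psi n)"
proof (induction n rule: less_induct)
  case (less n)
  show ?case
  proof (cases "n = 0")
    case False
    have IH: "int_qpoly n (psi i)" if "i < n" for i
      using int_qpoly_mono less that by (metis less_imp_le)
    \<comment> \<open>Only \<open>psi\<close> at indices up to n-k-\<nu>+1 occurs, and \<nu> >= 2
      keeps these below n.\<close>
    have "int_qpoly n (big_psi n psi)"
      unfolding big_psi_def
    proof (intro int_qpoly_sum int_qpoly_mult int_qpoly_partial_bell int_qpoly_qconst)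
      fix \<nu> k assume "\<nu> \<in> {2..n}" "k \<in> {0..min \<nu> (n - \<nu>)}"
      then show "(-1) ^ (\<nu> + 1) * of_int (stirling1 (\<nu> + 1) (k + 1)) * (fact n / fact (n - k)) \<in> (\<int> :: rat set)"
        by (intro Ints_mult fact_div_fact_Ints) auto
    qed (auto intro!: IH)
    then show ?thesis
      using False IH by (auto simp: psi_rec intro!: int_qpoly_add int_qpoly_mult
          int_qpoly_of_nat int_qpoly_sigma_star)
  qed (simp add: int_qpoly_0)
qed

section \<open>Bell polynomials as coefficients of powers\<close>

definition rat_bell :: "nat \<Rightarrow> nat \<Rightarrow> (nat \<Rightarrow> rat) \<Rightarrow> rat" where
  "rat_bell n k y = (\<Sum>j\<in>bell_index n k.
     fact n / (\<Prod>i=1..n-k+1. fact (j i)) * (\<Prod>i=1..n-k+1. (y i / fact i) ^ j i))"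

lemma qeval_partial_bell: "qeval (partial_bell n k y) a = rat_bell n k (\<lambda>i. qeval (y i) a)"
  by (simp add: partial_bell_def rat_bell_def qeval_sum qeval_mult qeval_prod qeval_power)

lemma rat_bell_cong:
  assumes "\<And>i. 1 \<le> i \<Longrightarrow> i \<le> n - k + 1 \<Longrightarrow> y i = z i"
  shows "rat_bell n k y = rat_bell n k z"
  unfolding rat_bell_def
  by (intro sum.cong refl arg_cong2[where f = "(*)"] prod.cong) (use assms in auto)

lemma rat_bell_0:
  assumes "k \<ge> 1"
  shows "rat_bell n k (\<lambda>_. 0) = 0"
  unfolding rat_bell_def
proof (rule sum.neutral, rule ballI)
  fix j assume "j \<in> bell_index n k"
  then have "(\<Sum>i=1..n-k+1. j i) = k" by (simp add: bell_index_def)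
  then have "\<exists>i\<in>{1..n-k+1}. j i \<noteq> 0"
    using assms by (metis sum.neutral not_one_le_zero)
  then have "(\<Prod>i=1..n-k+1. (0 / fact i :: rat) ^ j i) = 0"
    by (intro prod_zero) auto
  then show "fact n / (\<Prod>i=1..n-k+1. fact (j i)) * (\<Prod>i=1..n-k+1. (0 / fact i :: rat) ^ j i) = 0"
    by simp
qed

text \<open>Every Bell polynomial in the recurrence has positive second index, so it vanishes once
  all its arguments do.\<close>

lemma psi_const_term: "qeval (psi n) (\<lambda>_. 0) = 0"
proof (induction n rule: less_induct)
  case (less n)
  show ?case
  proof (cases "n = 0")
    case False
    have "qeval (sigma_star n) (\<lambda>_. 0) = 0"
      by (auto simp: sigma_star_def complete_bell_def qeval_mult qeval_sum qeval_partial_bell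
          qeval_uminus rat_bell_0)
    moreover have "qeval (big_psi n psi) (\<lambda>_. 0) = 0"
      unfolding big_psi_def qeval_sum
    proof (intro sum.neutral ballI)
      fix \<nu> k assume \<nu>: "\<nu> \<in> {2..n}" and k: "k \<in> {0..min \<nu> (n - \<nu>)}"
      have "rat_bell (n - k) \<nu> (\<lambda>i. qeval (psi i) (\<lambda>_. 0)) = rat_bell (n - k) \<nu> (\<lambda>_. 0)"
        by (rule rat_bell_cong, rule less) (use \<nu> k in auto)
      then show "qeval (qconst ((-1) ^ (\<nu>+1) * of_int (stirling1 (\<nu>+1) (k+1)) * (fact n / fact (n-k))) *
          partial_bell (n-k) \<nu> psi) (\<lambda>_. 0) = 0"
        using \<nu> by (simp add: qeval_mult qeval_partial_bell rat_bell_0)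
    qed
    ultimately show ?thesis
      using False less[of "n - 1"] by (simp add: psi_rec qeval_add qeval_mult)
  qed simp
qed

section \<open>The multinomial theorem for formal power series\<close>

lemma finite_PiE_sum_eq:
  fixes k :: nat
  assumes "finite I"
  shows "finite {j \<in> I \<rightarrow>\<^sub>E UNIV. sum j I = k}"
proof (rule finite_subset)
  show "{j \<in> I \<rightarrow>\<^sub>E UNIV. sum j I = k} \<subseteq> I \<rightarrow>\<^sub>E {..k}"
    using assms by (auto simp: PiE_def intro: member_le_sum)
qed (use assms in \<open>auto intro: finite_PiE\<close>)

text \<open>A tuple on \<open>insert x I\<close> with total k is its value l at x together with a
  tuple on I with total k - l.\<close>

lemma multinomial_insert:
  fixes f :: "nat \<Rightarrow> ('b \<Rightarrow> nat) \<Rightarrow> 'c::comm_monoid_add"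
  assumes "finite I" "x \<notin> I"
  shows "(\<Sum>j\<in>{j\<in>insert x I \<rightarrow>\<^sub>E UNIV. sum j (insert x I) = k}. f (j x) (restrict j I)) =
    (\<Sum>l\<le>k. \<Sum>j\<in>{j\<in>I \<rightarrow>\<^sub>E UNIV. sum j I = k - l}. f l j)"
proof -
  have "(\<Sum>l\<le>k. \<Sum>j\<in>{j\<in>I \<rightarrow>\<^sub>E UNIV. sum j I = k - l}. f l j) =
     (\<Sum>(l, j)\<in>(SIGMA l:{..k}. {j\<in>I \<rightarrow>\<^sub>E UNIV. sum j I = k - l}). f l j)"
    using finite_PiE_sum_eq[OF assms(1)] by (subst sum.Sigma) auto
  also have "\<dots> = (\<Sum>j\<in>{j\<in>insert x I \<rightarrow>\<^sub>E UNIV. sum j (insert x I) = k}. f (j x) (restrict j I))"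
  proof (rule sum.reindex_bij_witness[where i = "\<lambda>j. (j x, restrict j I)" and j = "\<lambda>(l, j). j(x := l)"], goal_cases)
    case (1 a)
    then show ?case using assms by (auto simp: fun_eq_iff PiE_iff extensional_def)
  next
    case (2 a)
    obtain l j where a: "a = (l, j)" by (cases a)
    have "sum (j(x := l)) I = sum j I"
      by (rule sum.cong) (use assms in auto)
    then show ?case using 2 assms by (auto simp: a PiE_iff extensional_def simp del: fun_upd_apply) (simp_all add: extensional_def)
  next
    case (3 b)
    then show ?case by (auto simp: fun_eq_iff PiE_iff extensional_def)
  next
    case (4 b)
    then show ?case using assms by (auto simp: PiE_iff)
  next
    case (5 a)
    have "restrict ((snd a)(x := fst a)) I = snd a"
      using 5 assms by (auto simp: fun_eq_iff PiE_iff extensional_def)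
    then show ?case by (auto simp: case_prod_unfold)
  qed
  finally show ?thesis ..
qed

text \<open>Binomial theorem and induction on I. The 1/j_i! stay inside the product, in the shape of
  the Bell coefficients.\<close>

lemma fps_multinomial:
  fixes a :: "'b \<Rightarrow> 'a::field_char_0 fps"
  assumes "finite I"
  shows "(\<Sum>i\<in>I. a i) ^ k = fps_const (fact k) *
    (\<Sum>j\<in>{j\<in>I \<rightarrow>\<^sub>E UNIV. sum j I = k}. \<Prod>i\<in>I. fps_const (1 / fact (j i)) * a i ^ j i)"
  using assms
proof (induction I arbitrary: k rule: finite_induct)
  case empty
  then show ?case by (cases k) auto
next
  case (insert x I)
  define g where "g I j = (\<Prod>i\<in>I. fps_const (1 / fact (j i)) * a i ^ j i)" for I j
  define J where "J k = {j\<in>I \<rightarrow>\<^sub>E UNIV. sum j I = k}" for k :: nat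
  have "(\<Sum>i\<in>insert x I. a i) ^ k = (a x + sum a I) ^ k"
    using insert by simp
  also have "\<dots> = (\<Sum>l\<le>k. of_nat (k choose l) * a x ^ l * sum a I ^ (k - l))"
    by (rule binomial_ring)
  also have "\<dots> = (\<Sum>l\<le>k. fps_const (fact k) * (\<Sum>j\<in>J (k - l). fps_const (1 / fact l) * a x ^ l * g I j))"
  proof (rule sum.cong[OF refl])
    fix l assume l: "l \<in> {..k}"
    \<comment> \<open>C(k,l) (k-l)! = k!/l! trades the factorial of the induction hypothesis for
      that of the claim.\<close>
    have c: "of_nat (k choose l) * fps_const (fact (k - l)) = fps_const (fact k) * fps_const (1 / fact l :: 'a)"
      using l by (simp add: binomial_fact flip: fps_of_nat)
    have "of_nat (k choose l) * a x ^ l * sum a I ^ (k - l) =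
        (of_nat (k choose l) * fps_const (fact (k - l))) * (a x ^ l * (\<Sum>j\<in>J (k - l). g I j))"
      unfolding insert.IH J_def g_def by (simp only: ac_simps)
    also have "\<dots> = fps_const (fact k) * (\<Sum>j\<in>J (k - l). fps_const (1 / fact l) * a x ^ l * g I j)"
      unfolding c by (simp only: sum_distrib_left ac_simps)
    finally show "of_nat (k choose l) * a x ^ l * sum a I ^ (k - l) =
      fps_const (fact k) * (\<Sum>j\<in>J (k - l). fps_const (1 / fact l) * a x ^ l * g I j)" .
  qed
  also have "\<dots> = fps_const (fact k) * (\<Sum>l\<le>k. \<Sum>j\<in>J (k - l). fps_const (1 / fact l) * a x ^ l * g I j)"
    by (simp only: sum_distrib_left)
  also have "(\<Sum>l\<le>k. \<Sum>j\<in>J (k - l). fps_const (1 / fact l) * a x ^ l * g I j) =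
     (\<Sum>j\<in>{j\<in>insert x I \<rightarrow>\<^sub>E UNIV. sum j (insert x I) = k}.
       fps_const (1 / fact (j x)) * a x ^ j x * g I (restrict j I))"
    unfolding J_def by (rule multinomial_insert[symmetric]) (use insert in auto)
  also have "\<dots> = (\<Sum>j\<in>{j\<in>insert x I \<rightarrow>\<^sub>E UNIV. sum j (insert x I) = k}. g (insert x I) j)"
    by (rule sum.cong[OF refl]) (use insert in \<open>simp add: g_def\<close>)
  finally show ?case unfolding g_def .
qed

section \<open>Bell polynomials and exponential generating functions\<close>

lemma fps_const_prod: "fps_const (prod f A) = (\<Prod>x\<in>A. fps_const (f x :: 'a::comm_semiring_1))"
  by (induction A rule: infinite_finite_induct) (simp_all flip: fps_const_mult)

text \<open>The exponential generating function of y_1, y_2, ...; its constant term is 0 whatever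
  \<open>y 0\<close> is, so k-th powers start at t^k or later.\<close>

definition egf :: "(nat \<Rightarrow> rat) \<Rightarrow> rat fps" where
  "egf y = Abs_fps (\<lambda>i. if i = 0 then 0 else y i / fact i)"

lemma egf_nth [simp]: "egf y $ i = (if i = 0 then 0 else y i / fact i)"
  by (simp add: egf_def)

lemma diff_dvd_power_diff:
  fixes x y :: "'a::comm_ring_1"
  shows "x - y dvd x ^ n - y ^ n"
  by (simp add: power_diff_sumr2)

text \<open>The classical identity F^k / k! = sum over m of B_{m,k} t^m / m!: cut F off, expand the
  power by the multinomial theorem and read off t^m.\<close>

lemma rat_bell_eq_coeff:
  assumes "k \<le> m"
  shows "rat_bell m k y = fact m / fact k * (egf y ^ k $ m)"
proof -
  \<comment> \<open>A product of k terms of positive degree and total degree m has no factor of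
    degree above m-k+1; \<open>F1\<close> is F cut off there.\<close>
  define M where "M = m - k + 1"
  define T where "T i = fps_const (y i / fact i) * fps_X ^ i" for i
  define F1 where "F1 = (\<Sum>i\<in>{1..M}. T i)"
  have T_nth: "T i $ l = (if i = l then y i / fact i else 0)" for i l
    by (simp add: T_def fps_X_power_nth)
  have F1_nth: "F1 $ l = (if l \<in> {1..M} then y l / fact l else 0)" for l
    by (simp add: F1_def fps_sum_nth T_nth)
  define A where "A = fps_shift 1 (egf y)"
  define A1 where "A1 = fps_shift 1 F1"
  have A: "egf y = fps_X * A"
    by (rule fps_ext) (simp add: A_def)
  have A1: "F1 = fps_X * A1"
    by (rule fps_ext) (simp add: A1_def F1_nth)
  \<comment> \<open>With one factor t removed, the series differ only from degree M on, hence so do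
    their k-th powers; restoring t^k moves the difference to degree M+k = m+1.\<close>
  have "A - A1 = fps_X ^ M * fps_shift M (A - A1)"
    by (rule fps_ext) (auto simp: fps_X_power_mult_nth A_def A1_def F1_nth)
  then have "fps_X ^ M dvd A - A1" by (rule dvdI)
  then have "fps_X ^ M dvd A ^ k - A1 ^ k" using diff_dvd_power_diff dvd_trans by blast
  then obtain R where R: "A ^ k - A1 ^ k = fps_X ^ M * R" by (elim dvdE)
  have "egf y ^ k - F1 ^ k = fps_X ^ k * (A ^ k - A1 ^ k)"
    by (simp add: A A1 power_mult_distrib algebra_simps)
  also have "\<dots> = fps_X ^ (m + 1) * R"
    unfolding R using assms by (simp add: M_def flip: mult.assoc power_add)
  finally have "(egf y ^ k - F1 ^ k) $ m = 0" by (simp only: fps_X_power_mult_nth) simp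
  then have "egf y ^ k $ m = F1 ^ k $ m" by simp
  also have "\<dots> = fact k * (\<Sum>j\<in>{j\<in>{1..M} \<rightarrow>\<^sub>E UNIV. sum j {1..M} = k}.
      (\<Prod>i\<in>{1..M}. fps_const (1 / fact (j i)) * T i ^ j i) $ m)"
    unfolding F1_def by (subst fps_multinomial) (simp_all add: fps_sum_nth)
  also have "\<dots> = fact k * (\<Sum>j\<in>{j\<in>{1..M} \<rightarrow>\<^sub>E UNIV. sum j {1..M} = k}.
      if (\<Sum>i\<in>{1..M}. i * j i) = m then (\<Prod>i\<in>{1..M}. 1 / fact (j i) * (y i / fact i) ^ j i) else 0)"
  proof (intro arg_cong2[where f = "(*)"] refl sum.cong)
    fix j
    have "(\<Prod>i\<in>{1..M}. fps_const (1 / fact (j i)) * T i ^ j i) =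
        (\<Prod>i\<in>{1..M}. fps_const (1 / fact (j i) * (y i / fact i) ^ j i) * fps_X ^ (i * j i))"
      by (rule prod.cong[OF refl])
         (simp only: T_def power_mult_distrib power_mult mult.assoc fps_const_power flip: fps_const_mult)
    also have "\<dots> = fps_const (\<Prod>i\<in>{1..M}. 1 / fact (j i) * (y i / fact i) ^ j i) *
        fps_X ^ (\<Sum>i\<in>{1..M}. i * j i)"

      by (simp only: prod.distrib power_sum fps_const_prod fps_const_mult [symmetric])
    finally show "(\<Prod>i\<in>{1..M}. fps_const (1 / fact (j i)) * T i ^ j i) $ m =
       (if (\<Sum>i\<in>{1..M}. i * j i) = m then (\<Prod>i\<in>{1..M}. 1 / fact (j i) * (y i / fact i) ^ j i) else 0)"
      by (simp only: fps_mult_left_const_nth fps_X_power_nth) auto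
  qed
  \<comment> \<open>Of the tuples with total k, those of weight m form
    \<open>bell_index m k\<close>; the others contribute 0.\<close>
  also have "\<dots> = fact k * (\<Sum>j\<in>bell_index m k. \<Prod>i\<in>{1..M}. 1 / fact (j i) * (y i / fact i) ^ j i)"
  proof -
    have sub: "bell_index m k \<subseteq> {j\<in>{1..M} \<rightarrow>\<^sub>E UNIV. sum j {1..M} = k}"
      by (auto simp: bell_index_def M_def)
    have fin: "finite {j\<in>{1..M} \<rightarrow>\<^sub>E UNIV. sum j {1..M} = k}"
      by (rule finite_PiE_sum_eq) simp
    show ?thesis
      by (intro arg_cong2[where f = "(*)"] refl sum.mono_neutral_cong_right[OF fin sub])
         (auto simp: bell_index_def M_def)
  qed
  also have "\<dots> = fact k / fact m * rat_bell m k y"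
  proof -
    have "(\<Prod>i\<in>{1..M}. 1 / fact (j i) * (y i / fact i) ^ j i) =
       1 / fact m * (fact m / (\<Prod>i=1..M. fact (j i)) * (\<Prod>i=1..M. (y i / fact i) ^ j i))" for j
      by (simp only: prod.distrib prod_dividef) simp
    then show ?thesis
      unfolding rat_bell_def M_def[symmetric] by (simp add: sum_distrib_left)
  qed
  finally show ?thesis by simp
qed

lemma egf_power_nth_eq_0: "m < k \<Longrightarrow> egf y ^ k $ m = 0"
  by (intro startsby_zero_power_prefix[rule_format]) auto

section \<open>Power sums and elementary symmetric functions\<close>

text \<open>L is the sum of the log(1 - q_a t). Both sides solve G' = L' G with G(0) = 1, and this
  determines every coefficient.\<close>

lemma prod_one_minus_eq_exp:
  fixes q :: "'b \<Rightarrow> rat"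
  assumes "finite A"
  defines "L \<equiv> Abs_fps (\<lambda>i. - (\<Sum>a\<in>A. q a ^ i) / of_nat i)"
  shows "(\<Prod>a\<in>A. 1 - fps_const (q a) * fps_X) = fps_exp 1 oo L"
proof -
  define P where "P A = (\<Prod>a\<in>A. 1 - fps_const (q a) * fps_X)" for A
  define D where "D A = Abs_fps (\<lambda>i. - (\<Sum>a\<in>A. q a ^ Suc i))" for A
  have DL: "fps_deriv L = D A"
    by (rule fps_ext) (simp add: L_def D_def del: power_Suc of_nat_Suc)
  have deriv: "fps_deriv (P A) = D A * P A"
    using assms(1)
  proof (induction A rule: finite_induct)
    case empty
    have "D {} = 0" by (rule fps_ext) (simp add: D_def)
    then show ?case by (simp add: P_def)
  next
    case (insert x B)
    have P: "P (insert x B) = (1 - fps_const (q x) * fps_X) * P B"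
      using insert by (simp add: P_def)
    have D: "D (insert x B) = D {x} + D B"
      by (rule fps_ext) (use insert in \<open>simp add: D_def\<close>)
    \<comment> \<open>\<open>D {x}\<close> is the geometric series of -q/(1 - q t), with q =
      \<open>q x\<close>.\<close>
    have x: "D {x} * (1 - fps_const (q x) * fps_X) = - fps_const (q x)"
    proof (rule fps_ext)
      fix n
      have "D {x} * (1 - fps_const (q x) * fps_X) = D {x} - fps_const (q x) * (fps_X * D {x})"
        by (simp add: algebra_simps)
      then show "(D {x} * (1 - fps_const (q x) * fps_X)) $ n = (- fps_const (q x)) $ n"
        by (cases n) (simp_all add: D_def)
    qed
    have "fps_deriv (P (insert x B)) = - fps_const (q x) * P B + (1 - fps_const (q x) * fps_X) * (D B * P B)"
      unfolding P by (simp add: insert.IH algebra_simps flip: fps_const_neg)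
    also have "\<dots> = D {x} * (1 - fps_const (q x) * fps_X) * P B + (1 - fps_const (q x) * fps_X) * (D B * P B)"
      unfolding x ..
    also have "\<dots> = D (insert x B) * P (insert x B)"
      unfolding P D by (simp only: algebra_simps)
    finally show ?case .
  qed
  define E where "E = fps_exp 1 oo L"
  \<comment> \<open>Division by 0 yields 0 at index 0, so the composition with L is
    meaningful.\<close>
  have L0: "L $ 0 = 0" by (simp add: L_def)
  have E: "fps_deriv E = D A * E"
    unfolding E_def using fps_compose_deriv[OF L0, of "fps_exp 1"] DL by (simp add: ac_simps)
  \<comment> \<open>The coefficient of t^m in G' = L' G expresses coefficient m+1 of G through the
    earlier ones.\<close>
  have "P A $ n = E $ n" for n
  proof (induction n rule: less_induct)
    case (less n)
    show ?case
    proof (cases n)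
      case 0
      have "P A $ 0 = 1"
        unfolding P_def using assms(1) by (induction rule: finite_induct) simp_all
      then show ?thesis using 0 by (simp add: E_def)
    next
      case (Suc m)
      have "of_nat (Suc m) * P A $ Suc m = (D A * P A) $ m"
        using deriv by (metis fps_deriv_nth Suc_eq_plus1)
      also have "\<dots> = (D A * E) $ m"
        unfolding fps_mult_nth by (rule sum.cong[OF refl]) (simp add: less Suc)
      also have "\<dots> = of_nat (Suc m) * E $ Suc m"
        using E by (metis fps_deriv_nth Suc_eq_plus1)
      finally show ?thesis using Suc by simp
    qed
  qed
  then show ?thesis unfolding P_def E_def by (intro fps_ext)
qed

text \<open>Substitution of -t for t; it accounts for the sign (-1)^n in
  \<open>sigma_star\<close>.\<close>

lemma prod_one_plus_nth:
  fixes q :: "'b \<Rightarrow> rat"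
  assumes "finite A"
  shows "(\<Prod>a\<in>A. 1 + fps_const (q a) * fps_X) $ n = (-1) ^ n * (\<Prod>a\<in>A. 1 - fps_const (q a) * fps_X) $ n"
  using assms
proof (induction A arbitrary: n rule: finite_induct)
  case empty
  then show ?case by (cases n) auto
next
  case (insert x A)
  then show ?case
    by (cases n) (simp_all add: algebra_simps)
qed

text \<open>With p_i the power sums, the Bell arguments divided by i! are -p_i/i, the coefficients
  of log prod(1 - q_a t); summing over k exponentiates. The result is Newton's passage to elementary
  symmetric functions.\<close>

lemma qeval_sigma_star:
  fixes q :: "'b \<Rightarrow> rat"
  assumes "finite A" "n \<ge> 1"
  shows "qeval (sigma_star n) (\<lambda>i. \<Sum>a\<in>A. q a ^ i) =
    fact n * (\<Prod>a\<in>A. 1 + fps_const (q a) * fps_X) $ n"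
proof -
  define y where "y i = - (fact (i - 1) * (\<Sum>a\<in>A. q a ^ i))" for i
  define L where "L = Abs_fps (\<lambda>i. - (\<Sum>a\<in>A. q a ^ i) / of_nat i)"
  have L: "L = egf y"
  proof (rule fps_ext)
    fix i show "L $ i = egf y $ i"
      by (cases i) (simp_all add: L_def y_def fact_Suc field_simps del: power_Suc of_nat_Suc)
  qed
  have "(\<Prod>a\<in>A. 1 - fps_const (q a) * fps_X) $ n = (\<Sum>k=0..n. 1 / fact k * (L ^ k) $ n)"
    unfolding L_def prod_one_minus_eq_exp[OF assms(1)] by (simp add: fps_compose_nth)
  \<comment> \<open>The term k = 0 of the exponential series is the constant 1, invisible at n >=
    1.\<close>
  also have "\<dots> = (\<Sum>k=1..n. 1 / fact k * (L ^ k) $ n)"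
    using assms(2) by (intro sum.mono_neutral_right) (auto simp: not_less_eq_eq)
  also have "\<dots> = (\<Sum>k=1..n. rat_bell n k y / fact n)"
    by (rule sum.cong) (simp_all add: L rat_bell_eq_coeff)
  finally have "(\<Sum>k=1..n. rat_bell n k y) = fact n * (\<Prod>a\<in>A. 1 - fps_const (q a) * fps_X) $ n"
    by (simp flip: sum_divide_distrib)
  then have "qeval (complete_bell n (\<lambda>i. - (qconst (fact (i - 1)) * qvar i))) (\<lambda>i. \<Sum>a\<in>A. q a ^ i) =
    fact n * (\<Prod>a\<in>A. 1 - fps_const (q a) * fps_X) $ n"
    by (simp add: complete_bell_def qeval_sum qeval_partial_bell qeval_uminus qeval_mult y_def[abs_def])
  then show ?thesis
    by (simp add: sigma_star_def qeval_mult qeval_power qeval_uminus prod_one_plus_nth[OF assms(1)])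
qed

section \<open>The functional equation of the generating function\<close>

text \<open>\<nu>! times the binomial coefficient t-1 over \<nu>, or (t)_{\<nu>+1} with its factor t
  removed.\<close>

definition falling_poly :: "nat \<Rightarrow> rat poly" where
  "falling_poly \<nu> = (\<Prod>i=1..\<nu>. [:- of_nat i, 1:])"

text \<open>The product defining \<open>stirling1 (\<nu> + 1)\<close> has the extra factor t, which
  raises exponents by one.\<close>

lemma coeff_falling_poly: "poly.coeff (falling_poly \<nu>) k = of_int (stirling1 (\<nu> + 1) (k + 1))"
proof -
  define Q where "Q = (\<Prod>i=1..\<nu>. [:- int i, 1:])"
  have "(\<Prod>i<\<nu>+1. [:- int i, 1:]) = [:0, 1:] * Q"
    unfolding Q_def by (simp add: prod.lessThan_Suc_shift prod.atLeast1_atMost_eq del: prod.lessThan_Suc)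
  then have "stirling1 (\<nu> + 1) (k + 1) = poly.coeff Q k"
    unfolding stirling1_def by simp
  moreover have "poly.coeff (falling_poly \<nu>) k = of_int (poly.coeff Q k)"
    unfolding falling_poly_def Q_def
  proof (induction \<nu> arbitrary: k)
    case (Suc \<nu>)
    then show ?case
      by (cases k) (simp_all add: mult.commute[of _ "[:_, 1:]"])
  qed (cases k; simp)
  ultimately show ?thesis by simp
qed

lemma degree_falling_poly: "Polynomial.degree (falling_poly \<nu>) = \<nu>"
  unfolding falling_poly_def by (subst degree_prod_eq_sum_degree) auto

text \<open>At t = p the formal exponent t - 1 becomes p - 1, so ordinary binomial coefficients
  appear.\<close>

lemma poly_falling_poly:
  assumes "p \<ge> 1"
  shows "poly (falling_poly \<nu>) (of_nat p) = fact \<nu> * of_nat ((p - 1) choose \<nu>)"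
proof -
  have "poly (falling_poly \<nu>) (of_nat p) = (\<Prod>i=0..<\<nu>. (of_nat (p - 1) - of_nat i :: rat))"
    unfolding falling_poly_def poly_prod using assms
    by (simp add: prod.atLeast1_atMost_eq of_nat_diff algebra_simps atLeast0LessThan)
  also have "\<dots> = fact \<nu> * (of_nat (p - 1) gchoose \<nu>)"
    by (simp add: gbinomial_prod_rev)
  finally show ?thesis by (simp add: binomial_gbinomial)
qed

text \<open>F cut off after degree n; a polynomial, because t will be replaced by the number
  p.\<close>

definition egf_poly :: "nat \<Rightarrow> (nat \<Rightarrow> rat) \<Rightarrow> rat poly" where
  "egf_poly n y = (\<Sum>\<nu>=1..n. Polynomial.monom (y \<nu> / fact \<nu>) \<nu>)"

lemma coeff_egf_poly: "poly.coeff (egf_poly n y) i = (if 1 \<le> i \<and> i \<le> n then y i / fact i else 0)"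
  by (auto simp: egf_poly_def coeff_sum)

lemma coeff_egf_poly_power:
  assumes "k \<ge> 1" "m \<le> n"
  shows "poly.coeff (egf_poly n y ^ k) m = (if k \<le> m then fact k / fact m * rat_bell m k y else 0)"
proof -
  \<comment> \<open>Setting y to 0 beyond n makes the polynomial a full \<open>egf\<close>;
    coefficients up to degree n only involve indices up to n.\<close>
  define z where "z i = (if i \<le> n then y i else 0)" for i
  have "fps_of_poly (egf_poly n y) = egf z"
    by (rule fps_ext) (auto simp: coeff_egf_poly z_def)
  then have "poly.coeff (egf_poly n y ^ k) m = egf z ^ k $ m"
    by (metis fps_of_poly_nth fps_of_poly_power)
  moreover have "rat_bell m k z = rat_bell m k y" if "k \<le> m"
    by (rule rat_bell_cong) (use assms that in \<open>auto simp: z_def\<close>)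
  ultimately show ?thesis
    using rat_bell_eq_coeff[of k m z] by (cases "k \<le> m") (simp_all add: egf_power_nth_eq_0 field_simps)
qed

text \<open>A truncation of the binomial series of \<open>(1 - F(t))\<^bsup>t-1\<^esup>\<close>, where \<open>F\<close> is \<^const>\<open>egf_poly\<close>.\<close>

definition binomial_poly :: "nat \<Rightarrow> (nat \<Rightarrow> rat) \<Rightarrow> rat poly" where
  "binomial_poly n y = (\<Sum>\<nu>\<le>n. Polynomial.smult ((-1) ^ \<nu> / fact \<nu>) (falling_poly \<nu> * egf_poly n y ^ \<nu>))"

text \<open>Cauchy product: \<open>falling_poly\<close> has degree \<nu>, so k <= \<nu>, and F^\<nu>
  has no term below t^\<nu>, so k <= m-\<nu>. Hence the minimum in the recurrence.\<close>

lemma coeff_falling_mult_egf_power: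
  assumes "\<nu> \<ge> 1" "\<nu> \<le> m" "m \<le> n"
  shows "poly.coeff (falling_poly \<nu> * egf_poly n y ^ \<nu>) m =
    fact \<nu> / fact m * (\<Sum>k=0..min \<nu> (m - \<nu>).
      of_int (stirling1 (\<nu> + 1) (k + 1)) * (fact m / fact (m - k)) * rat_bell (m - k) \<nu> y)"
proof -
  have "poly.coeff (falling_poly \<nu> * egf_poly n y ^ \<nu>) m =
      (\<Sum>k\<le>m. poly.coeff (falling_poly \<nu>) k * poly.coeff (egf_poly n y ^ \<nu>) (m - k))"
    by (rule coeff_mult)
  also have "\<dots> = (\<Sum>k=0..min \<nu> (m - \<nu>). poly.coeff (falling_poly \<nu>) k * poly.coeff (egf_poly n y ^ \<nu>) (m - k))"
  proof (rule sum.mono_neutral_right)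
    show "\<forall>k\<in>{..m} - {0..min \<nu> (m - \<nu>)}.
      poly.coeff (falling_poly \<nu>) k * poly.coeff (egf_poly n y ^ \<nu>) (m - k) = 0"
    proof
      fix k assume k: "k \<in> {..m} - {0..min \<nu> (m - \<nu>)}"
      show "poly.coeff (falling_poly \<nu>) k * poly.coeff (egf_poly n y ^ \<nu>) (m - k) = 0"
      proof (cases "k > \<nu>")
        case True
        then show ?thesis by (simp add: coeff_eq_0 degree_falling_poly)
      next
        case False
        with k assms have "\<not> \<nu> \<le> m - k" by auto
        then show ?thesis using assms by (simp add: coeff_egf_poly_power)
      qed
    qed
  qed auto
  also have "\<dots> = (\<Sum>k=0..min \<nu> (m - \<nu>). fact \<nu> / fact m * (of_int (stirling1 (\<nu> + 1) (k + 1)) *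
      (fact m / fact (m - k)) * rat_bell (m - k) \<nu> y))"
    by (rule sum.cong) (use assms in \<open>auto simp: coeff_egf_poly_power coeff_falling_poly\<close>)
  finally show ?thesis by (simp only: sum_distrib_left)
qed

text \<open>The term \<nu> = 1 is -(t-1)F = F - tF and gives the linear part; the terms \<nu> >= 2
  give the sum in \<open>big_psi\<close> with the opposite sign.\<close>

lemma coeff_binomial_poly:
  assumes m: "1 \<le> m" "m \<le> n"
    and y0: "y 0 = 0"
  shows "fact m * poly.coeff (binomial_poly n y) m = y m - of_nat m * y (m - 1)
     - (\<Sum>\<nu>=2..m. \<Sum>k=0..min \<nu> (m-\<nu>).
     (-1) ^ (\<nu>+1) * of_int (stirling1 (\<nu>+1) (k+1)) * (fact m / fact (m-k)) * rat_bell (m-k) \<nu> y)"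
proof -
  define c where "c \<nu> = (-1) ^ \<nu> / fact \<nu> * poly.coeff (falling_poly \<nu> * egf_poly n y ^ \<nu>) m" for \<nu>
  have "poly.coeff (binomial_poly n y) m = (\<Sum>\<nu>\<le>n. c \<nu>)"
    by (simp add: binomial_poly_def coeff_sum c_def)
  also have "\<dots> = (\<Sum>\<nu>\<le>m. c \<nu>)"
  proof (rule sum.mono_neutral_right)
    show "\<forall>\<nu>\<in>{..n} - {..m}. c \<nu> = 0"
      using m by (auto simp: c_def coeff_mult coeff_egf_poly_power intro!: sum.neutral)
  qed (use m in auto)
  also have "{..m} = insert 0 (insert 1 {2..m})" using m by auto
  also have "(\<Sum>\<nu>\<in>\<dots>. c \<nu>) = c 0 + c 1 + (\<Sum>\<nu>=2..m. c \<nu>)" by simp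
  also have "c 0 = 0" using m by (simp add: c_def falling_poly_def)
  also have "fact m * (0 + c 1 + (\<Sum>\<nu>=2..m. c \<nu>)) = fact m * c 1 + (\<Sum>\<nu>=2..m. fact m * c \<nu>)"
    by (simp add: algebra_simps sum_distrib_left)
  \<comment> \<open>For m = 1 the term tF contributes nothing, while the formula shows
    \<open>y 0\<close>; this is why \<open>y 0 = 0\<close> is assumed.\<close>
  also have "fact m * c 1 = y m - of_nat m * y (m - 1)"
  proof -
    obtain l where l: "m = Suc l" using m by (cases m) auto
    have "c 1 = y m / fact m - y l / fact l"
      using m y0 by (cases "l = 0") (simp_all add: c_def falling_poly_def l coeff_egf_poly del: fact_Suc)
    then have "fact m * c 1 = y m - fact m / fact l * y l"
      by (simp add: right_diff_distrib)
    then show ?thesis by (simp add: l)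
  qed
  also have "(\<Sum>\<nu>=2..m. fact m * c \<nu>) = (\<Sum>\<nu>=2..m. - (\<Sum>k=0..min \<nu> (m-\<nu>).
     (-1) ^ (\<nu>+1) * of_int (stirling1 (\<nu>+1) (k+1)) * (fact m / fact (m-k)) * rat_bell (m-k) \<nu> y))"
  proof (rule sum.cong[OF refl])
    fix \<nu> assume \<nu>: "\<nu> \<in> {2..m}"
    have "fact m * c \<nu> = (-1) ^ \<nu> * (\<Sum>k=0..min \<nu> (m - \<nu>).
      of_int (stirling1 (\<nu> + 1) (k + 1)) * (fact m / fact (m - k)) * rat_bell (m - k) \<nu> y)"
      using \<nu> m by (simp add: c_def coeff_falling_mult_egf_power)
    then show "fact m * c \<nu> = - (\<Sum>k=0..min \<nu> (m-\<nu>).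
     (-1) ^ (\<nu>+1) * of_int (stirling1 (\<nu>+1) (k+1)) * (fact m / fact (m-k)) * rat_bell (m-k) \<nu> y)"
      by (simp add: sum_distrib_left sum_negf mult.assoc)
  qed
  finally show ?thesis by (simp add: sum_negf)
qed

text \<open>The recurrence, solved for \<open>sigma_star m\<close>, is the comparison of
  coefficients of t^m in (1-F)^(t-1) = prod(1 + q_a t); the constant terms are both 1.\<close>

lemma coeff_binomial_poly_psi:
  fixes q :: "'b \<Rightarrow> rat"
  assumes "finite A" "m \<le> n"
  shows "poly.coeff (binomial_poly n (\<lambda>i. qeval (psi i) (\<lambda>k. \<Sum>a\<in>A. q a ^ k))) m =
    poly.coeff (\<Prod>a\<in>A. [:1, q a:]) m"
proof -
  define y where "y i = qeval (psi i) (\<lambda>k. \<Sum>a\<in>A. q a ^ k)" for i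
  have fps: "poly.coeff (\<Prod>a\<in>A. [:1, q a:]) m = (\<Prod>a\<in>A. 1 + fps_const (q a) * fps_X) $ m"
    by (simp flip: fps_of_poly_nth add: fps_of_poly_prod fps_of_poly_pCons)
  have "poly.coeff (binomial_poly n y) m = (\<Prod>a\<in>A. 1 + fps_const (q a) * fps_X) $ m"
  proof (cases "m = 0")
    case True
    have "poly.coeff (egf_poly n y) 0 = 0" by (simp add: coeff_egf_poly)
    then have "poly.coeff (binomial_poly n y) 0 =
        (\<Sum>\<nu>\<le>n. if \<nu> = 0 then 1 else 0)"
      unfolding binomial_poly_def coeff_sum
      by (intro sum.cong) (auto simp: coeff_mult_0 coeff_0_power falling_poly_def)
    moreover have "(\<Prod>a\<in>A. 1 + fps_const (q a) * fps_X) $ 0 = 1"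
      using assms(1) by (induction rule: finite_induct) simp_all
    ultimately show ?thesis using True by simp
  next
    case False
    then have m: "m \<ge> 1" by simp
    have "y m = of_nat m * y (m - 1) + qeval (sigma_star m) (\<lambda>k. \<Sum>a\<in>A. q a ^ k) +
      (\<Sum>\<nu>=2..m. \<Sum>k=0..min \<nu> (m-\<nu>).
     (-1) ^ (\<nu>+1) * of_int (stirling1 (\<nu>+1) (k+1)) * (fact m / fact (m-k)) * rat_bell (m-k) \<nu> y)"
      unfolding y_def psi_rec[OF m]
      by (simp only: qeval_add qeval_mult qeval_of_nat big_psi_def qeval_sum qeval_qconst qeval_partial_bell)
    moreover have "y 0 = 0" by (simp add: y_def)
    ultimately have "fact m * poly.coeff (binomial_poly n y) m =
        qeval (sigma_star m) (\<lambda>k. \<Sum>a\<in>A. q a ^ k)"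
      using coeff_binomial_poly[OF m assms(2), of y] by linarith
    also have "\<dots> = fact m * (\<Prod>a\<in>A. 1 + fps_const (q a) * fps_X) $ m"
      by (rule qeval_sigma_star[OF assms(1) m])
    finally show ?thesis by simp
  qed
  then show ?thesis unfolding fps y_def[abs_def] .
qed

section \<open>Rational numbers integral at a prime\<close>

text \<open>The reduced denominator divides every other denominator of the same number, so fractions
  need not be in lowest terms below.\<close>

lemma p_integral_iff:
  assumes "prime p"
  shows "p_integral p r \<longleftrightarrow> (\<exists>a b. \<not> int p dvd b \<and> r = of_int a / of_int b)"
proof
  assume *: "p_integral p r"
  obtain a b where ab: "quotient_of r = (a, b)" by (cases "quotient_of r")
  have "\<not> int p dvd b"
  proof
    assume "int p dvd b"
    moreover have "coprime b (int p)" using * ab by (simp add: p_integral_def)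
    ultimately have "is_unit (int p)" by (metis coprime_absorb_right)
    then show False using assms prime_gt_1_nat by auto
  qed
  then show "\<exists>a b. \<not> int p dvd b \<and> r = of_int a / of_int b"
    using quotient_of_div[OF ab] by blast
next
  assume "\<exists>a b. \<not> int p dvd b \<and> r = of_int a / of_int b"
  then obtain a b where ab: "\<not> int p dvd b" "r = of_int a / of_int b" by blast
  obtain c d where cd: "quotient_of r = (c, d)" by (cases "quotient_of r")
  have "b \<noteq> 0" "d > 0" using ab quotient_of_denom_pos[OF cd] by auto
  then have "of_int (c * b) = (of_int (a * d) :: rat)"
    using ab quotient_of_div[OF cd] by (simp add: field_simps)
  then have "d dvd c * b" by (simp only: of_int_eq_iff) simp
  then have "d dvd b" using quotient_of_coprime[OF cd] by (simp add: coprime_commute coprime_dvd_mult_right_iff)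
  then have "\<not> int p dvd d" using ab(1) dvd_trans by blast
  then have "coprime (int p) d" using assms by (simp add: prime_imp_coprime)
  then show "p_integral p r" by (simp add: p_integral_def cd coprime_commute)
qed

text \<open>The ideal p^n Z_(p) when p is prime.\<close>

definition p_multiple :: "nat \<Rightarrow> nat \<Rightarrow> rat \<Rightarrow> bool" where
  "p_multiple p n r \<longleftrightarrow> (\<exists>c. p_integral p c \<and> r = of_nat p ^ n * c)"

context
  fixes p :: nat
  assumes p: "prime p"
begin

lemma p_integral_of_int: "p_integral p (of_int a)"
  unfolding p_integral_def by simp

lemma p_integral_Ints: "r \<in> \<int> \<Longrightarrow> p_integral p r"
  using p_integral_of_int by (auto elim: Ints_cases)

lemma p_integral_mult:
  assumes "p_integral p r" "p_integral p s"
  shows "p_integral p (r * s)"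
proof -
  obtain a b where "\<not> int p dvd b" "r = of_int a / of_int b"
    using assms p_integral_iff[OF p] by blast
  moreover obtain c d where "\<not> int p dvd d" "s = of_int c / of_int d"
    using assms p_integral_iff[OF p] by blast
  ultimately have "\<not> int p dvd b * d \<and> r * s = of_int (a * c) / of_int (b * d)"
    using p by (simp add: prime_dvd_mult_iff)
  then show ?thesis using p_integral_iff[OF p] by blast
qed

lemma p_integral_add:
  assumes "p_integral p r" "p_integral p s"
  shows "p_integral p (r + s)"
proof -
  obtain a b where ab: "\<not> int p dvd b" "r = of_int a / of_int b"
    using assms p_integral_iff[OF p] by blast
  obtain c d where cd: "\<not> int p dvd d" "s = of_int c / of_int d"
    using assms p_integral_iff[OF p] by blast
  have "b \<noteq> 0" "d \<noteq> 0" using ab cd by auto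
  then have "\<not> int p dvd b * d \<and> r + s = of_int (a * d + c * b) / of_int (b * d)"
    using p ab cd by (simp add: prime_dvd_mult_iff field_simps)
  then show ?thesis using p_integral_iff[OF p] by blast
qed

lemma p_integral_uminus: "p_integral p r \<Longrightarrow> p_integral p (- r)"
  using p_integral_mult[OF p_integral_of_int[of "-1"]] by simp

lemma p_integral_diff: "p_integral p r \<Longrightarrow> p_integral p s \<Longrightarrow> p_integral p (r - s)"
  using p_integral_add[OF _ p_integral_uminus] by simp

lemma p_integral_sum: "(\<And>x. x \<in> A \<Longrightarrow> p_integral p (f x)) \<Longrightarrow> p_integral p (sum f A)"
  using p_integral_of_int[of 0]
  by (induction A rule: infinite_finite_induct) (simp_all add: p_integral_add)

lemma p_integral_prod: "(\<And>x. x \<in> A \<Longrightarrow> p_integral p (f x)) \<Longrightarrow> p_integral p (prod f A)"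
  using p_integral_of_int[of 1]
  by (induction A rule: infinite_finite_induct) (simp_all add: p_integral_mult)

lemma p_integral_power: "p_integral p r \<Longrightarrow> p_integral p (r ^ n)"
  using p_integral_of_int[of 1] by (induction n) (simp_all add: p_integral_mult)

text \<open>For n < p the factorial n! is prime to p; this is how p > n keeps all denominators
  harmless.\<close>

lemma p_integral_divide_fact:
  assumes "p_integral p r" "n < p"
  shows "p_integral p (r / fact n)"
proof -
  have "\<not> p dvd fact n" using p assms by (simp add: prime_dvd_fact_iff)
  then have "\<not> int p dvd fact n" by (metis of_nat_fact of_nat_dvd_iff)
  then have "p_integral p (of_int 1 / of_int (fact n))"
    using p_integral_iff[OF p] by blast
  then show ?thesis using p_integral_mult[OF assms(1)] by fastforce
qed

text \<open>An element congruent to -1 modulo p is a unit: for c = a/b its numerator pa - b is prime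
  to p.\<close>

lemma p_integral_inverse_unit:
  assumes "p_integral p c"
  shows "p_integral p (1 / (of_nat p * c - 1))"
proof -
  obtain a b where ab: "\<not> int p dvd b" "c = of_int a / of_int b"
    using assms p_integral_iff[OF p] by blast
  have "\<not> int p dvd int p * a - b" using ab(1) by (simp add: dvd_diff_right_iff)
  moreover have "1 / (of_nat p * c - 1) = of_int b / (of_int (int p * a - b) :: rat)"
  proof -
    have "b \<noteq> 0" using ab by auto
    then have "of_nat p * c - 1 = of_int (int p * a - b) / (of_int b :: rat)"
      using ab by (simp add: field_simps)
    then show ?thesis by simp
  qed
  ultimately show ?thesis using p_integral_iff[OF p] by blast
qed

lemma p_integral_qeval:
  assumes "int_qpoly N P" "\<And>i. p_integral p (a i)"
  shows "p_integral p (qeval P a)"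
  unfolding qeval_def using assms
  by (intro p_integral_sum p_integral_mult p_integral_prod p_integral_power)
     (auto simp: int_qpoly_def p_integral_Ints)

section \<open>Divisibility by powers of p in the localization\<close>

lemma p_multiple_add: "p_multiple p n r \<Longrightarrow> p_multiple p n s \<Longrightarrow> p_multiple p n (r + s)"
  unfolding p_multiple_def by (metis distrib_left p_integral_add)

lemma p_multiple_mult: "p_multiple p n r \<Longrightarrow> p_integral p s \<Longrightarrow> p_multiple p n (r * s)"
  unfolding p_multiple_def by (metis mult.assoc p_integral_mult)

lemma p_multiple_0: "p_multiple p n 0"
  unfolding p_multiple_def using p_integral_of_int[of 0] by (metis mult_zero_right of_int_0)

lemma p_multiple_uminus: "p_multiple p n r \<Longrightarrow> p_multiple p n (- r)"
  using p_multiple_mult[OF _ p_integral_of_int[of "-1"]] by simp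

lemma p_multiple_sum: "(\<And>x. x \<in> A \<Longrightarrow> p_multiple p n (f x)) \<Longrightarrow> p_multiple p n (sum f A)"
  by (induction A rule: infinite_finite_induct) (simp_all add: p_multiple_0 p_multiple_add)

lemma p_multiple_power_mult:
  assumes "p_integral p c" "n \<le> m"
  shows "p_multiple p n (of_nat p ^ m * c)"
proof -
  have "of_nat p ^ m * c = of_nat p ^ n * (of_nat p ^ (m - n) * c)"
    using assms(2) by (simp flip: mult.assoc power_add)
  moreover have "p_integral p (of_nat p ^ (m - n) * c)"
    using assms(1) p_integral_of_int[of "int p"] by (intro p_integral_mult p_integral_power) simp_all
  ultimately show ?thesis unfolding p_multiple_def by blast
qed

lemma p_multiple_power:
  assumes "p_multiple p 1 r" "n \<le> m"
  shows "p_multiple p n (r ^ m)"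
proof -
  obtain c where "p_integral p c" "r = of_nat p * c"
    using assms(1) by (auto simp: p_multiple_def)
  then show ?thesis
    using assms(2) by (simp add: power_mult_distrib p_integral_power p_multiple_power_mult)
qed

lemma p_integral_p_multiple: "p_multiple p n r \<Longrightarrow> p_integral p r"
  unfolding p_multiple_def using p_integral_of_int[of "int p"]
  by (auto intro!: p_integral_mult p_integral_power)

lemma p_multiple_poly:
  assumes "\<And>i. p_integral p (poly.coeff P i)" "\<And>i. i < n \<Longrightarrow> poly.coeff P i = 0"
  shows "p_multiple p n (poly P (of_nat p))"
  unfolding poly_altdef
proof (intro p_multiple_sum)
  fix i
  show "p_multiple p n (poly.coeff P i * of_nat p ^ i)"
  proof (cases "i < n")
    case False
    then show ?thesis
      using p_multiple_power_mult[OF assms(1)[of i], of n i] by (simp add: mult.commute)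
  qed (simp add: assms p_multiple_0)
qed

text \<open>With x = 1-u and y = 1-v, the difference x^(p-1) - y^(p-1) is x-y times a sum of p-1
  products congruent to 1 modulo p. That sum is congruent to -1, hence a unit.\<close>

lemma p_multiple_cancel_power:
  assumes "p_multiple p 1 u" "p_multiple p 1 v"
    and "p_multiple p n ((1 - u) ^ (p - 1) - (1 - v) ^ (p - 1))"
  shows "p_multiple p n (u - v)"
proof -
  have p1: "p > 1" using p by (rule prime_gt_1_nat)
  have one: "p_multiple p 1 ((1 - r) ^ k - 1)" if "p_multiple p 1 r" for r k
  proof -
    have "(1 - r) ^ k - 1 = - r * (\<Sum>i<k. (1 - r) ^ i)"
      using power_diff_sumr2[of "1 - r" k 1] by simp
    moreover have "p_integral p (\<Sum>i<k. (1 - r) ^ i)"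
      using that p_integral_of_int[of 1]
      by (auto intro!: p_integral_sum p_integral_power p_integral_diff dest: p_integral_p_multiple)
    ultimately show ?thesis using that by (metis p_multiple_mult p_multiple_uminus)
  qed
  define S where "S = (\<Sum>i<p - 1. (1 - v) ^ (p - 1 - Suc i) * (1 - u) ^ i)"
  have S: "(1 - u) ^ (p - 1) - (1 - v) ^ (p - 1) = - ((u - v) * S)"
    unfolding power_diff_sumr2 S_def by (simp add: algebra_simps)
  have "p_multiple p 1 (\<Sum>i<p - 1. (1 - v) ^ (p - 1 - Suc i) * (1 - u) ^ i - 1)"
  proof (rule p_multiple_sum)
    fix i
    let ?x = "(1 - v) ^ (p - 1 - Suc i)" and ?y = "(1 - u) ^ i"
    have "?x * ?y - 1 = (?x - 1) * ?y + (?y - 1)" by (simp add: algebra_simps)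
    moreover have "p_integral p ?y"
      using assms(1) p_integral_of_int[of 1]
      by (auto intro!: p_integral_power p_integral_diff dest: p_integral_p_multiple)
    ultimately show "p_multiple p 1 (?x * ?y - 1)"
      using one[OF assms(1)] one[OF assms(2)] by (metis p_multiple_add p_multiple_mult)
  qed
  also have "(\<Sum>i<p - 1. (1 - v) ^ (p - 1 - Suc i) * (1 - u) ^ i - 1) = S - of_nat p + 1"
    using p1 by (simp add: sum_subtractf S_def of_nat_diff)
  finally obtain c where c: "p_integral p c" "S - of_nat p + 1 = of_nat p * c"
    by (auto simp: p_multiple_def)
  define d where "d = 1 / (of_nat p * (c + 1) - 1)"
  have d: "p_integral p d"
    unfolding d_def using c p_integral_of_int[of 1] by (intro p_integral_inverse_unit p_integral_add) simp_all
  have S': "S = of_nat p * (c + 1) - 1" using c(2) by (simp add: algebra_simps)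
  \<comment> \<open>S = 0 would make p a unit. Excluding it makes \<open>d\<close> a true inverse
    rather than the default value of 1/0.\<close>
  have "S \<noteq> 0"
  proof
    assume "S = 0"
    then have c': "of_nat p * (c + 1) = 1" using S' by simp
    have "p_integral p (c + 1)" using c(1) p_integral_of_int[of 1] by (simp add: p_integral_add)
    then obtain a b where ab: "\<not> int p dvd b" "c + 1 = of_int a / of_int b"
      using p_integral_iff[OF p] by blast
    then have "b \<noteq> 0" by auto
    with c' have "of_int (int p * a) = (of_int b :: rat)" unfolding ab(2) by (simp add: field_simps)
    then have "int p * a = b" by (simp only: of_int_eq_iff)
    then show False using ab(1) by auto
  qed
  then have "u - v = - ((1 - u) ^ (p - 1) - (1 - v) ^ (p - 1)) * d"
    unfolding S d_def S'[symmetric] by simp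
  then show ?thesis using assms(3) d by (metis p_multiple_mult p_multiple_uminus)
qed

section \<open>Integrality of the Fermat and Wilson quotients\<close>

lemma p_integral_fermat_quotient:
  assumes "a \<in> {1..p - 1}"
  shows "p_integral p (fermat_quotient p (int a))"
proof -
  have "\<not> p dvd a" using assms by (auto dest: dvd_imp_le)
  then have "[a ^ (p - 1) = 1] (mod p)" using p by (intro fermat_theorem)
  then have "[int a ^ (p - 1) = 1] (mod int p)" by (metis cong_int_iff of_nat_1 of_nat_power)
  then obtain k where "int a ^ (p - 1) - 1 = int p * k"
    by (auto simp: cong_iff_dvd_diff elim: dvdE)
  then have "of_int (int a ^ (p - 1) - 1) = (of_int (int p * k) :: rat)" by simp
  then have "fermat_quotient p (int a) = of_int k"
    using p prime_gt_0_nat by (simp add: fermat_quotient_def)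
  then show ?thesis using p_integral_of_int by simp
qed

lemma p_integral_wilson_quotient: "p_integral p (wilson_quotient p)"
proof -
  have "[fact (p - 1) = - 1] (mod int p)" using p by (rule wilson_theorem)
  then obtain k where "fact (p - 1) + 1 = int p * k"
    by (auto simp: cong_iff_dvd_diff elim: dvdE)
  then have "of_int (fact (p - 1) + 1) = (of_int (int p * k) :: rat)" by simp
  then have "wilson_quotient p = of_int k"
    using p prime_gt_0_nat by (simp add: wilson_quotient_def)
  then show ?thesis using p_integral_of_int by simp
qed

section \<open>The congruence\<close>

text \<open>Here 1 + p q_p(a) = a^(p-1). As p-1 is even, (p-1)! may change sign, which makes the
  base congruent to 1 modulo p.\<close>

lemma prod_fermat_quotients:
  assumes "odd p"
  shows "(\<Prod>a=1..p-1. 1 + of_nat p * fermat_quotient p (int a)) =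
    (1 - of_nat p * wilson_quotient p) ^ (p - 1)"
proof -
  have p0: "p > 0" using p by (rule prime_gt_0_nat)
  have "(\<Prod>a=1..p-1. 1 + of_nat p * fermat_quotient p (int a)) = (\<Prod>a=1..p-1. (of_nat a :: rat)) ^ (p - 1)"
    unfolding prod_power_distrib using p0 by (intro prod.cong) (simp_all add: fermat_quotient_def)
  also have "(\<Prod>a=1..p-1. (of_nat a :: rat)) = fact (p - 1)" by (simp add: fact_prod)
  also have "\<dots> ^ (p - 1) = (- fact (p - 1)) ^ (p - 1)" using assms p0 by simp
  also have "- fact (p - 1) = 1 - of_nat p * wilson_quotient p"
    using p0 by (simp add: wilson_quotient_def)
  finally show ?thesis .
qed

lemma p_integral_coeff_prod:
  assumes "\<And>x i. x \<in> A \<Longrightarrow> p_integral p (poly.coeff (f x) i)"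
  shows "p_integral p (poly.coeff (prod f A) i)"
  using assms
proof (induction A arbitrary: i rule: infinite_finite_induct)
  case (insert x A)
  then show ?case
    by (auto simp: coeff_mult intro!: p_integral_sum p_integral_mult)
qed (use p_integral_of_int[of 0] p_integral_of_int[of 1] in \<open>auto simp: coeff_1\<close>)

text \<open>The denominators are the \<nu>! of the binomial series and the i! in F, with \<nu> and i
  at most n < p.\<close>

lemma p_integral_coeff_binomial_poly:
  assumes "n < p" "\<And>i. p_integral p (y i)"
  shows "p_integral p (poly.coeff (binomial_poly n y) i)"
proof -
  have F: "p_integral p (poly.coeff (egf_poly n y) i)" for i
    using assms p_integral_of_int[of 0] by (auto simp: coeff_egf_poly intro!: p_integral_divide_fact)
  have "p_integral p (poly.coeff (egf_poly n y ^ \<nu>) i)" for \<nu> i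
    using p_integral_coeff_prod[of "{..<\<nu>}" "\<lambda>_. egf_poly n y"] F by simp
  then have "p_integral p (poly.coeff (falling_poly \<nu> * egf_poly n y ^ \<nu>) i)" for \<nu> i
    unfolding coeff_mult coeff_falling_poly
    by (intro p_integral_sum p_integral_mult p_integral_of_int)
  moreover have "p_integral p ((-1) ^ \<nu> / fact \<nu>)" if "\<nu> \<le> n" for \<nu>
    using p_integral_of_int[of "(-1) ^ \<nu>"] that assms(1) by (intro p_integral_divide_fact) auto
  ultimately show ?thesis
    unfolding binomial_poly_def coeff_sum coeff_smult by (intro p_integral_sum p_integral_mult) auto
qed

lemma p_multiple_wilson_psi:
  assumes "odd p" "n < p"
  shows "p_multiple p (n + 1) (of_nat p * wilson_quotient p -
    (\<Sum>\<nu>=1..n. of_nat p ^ \<nu> / fact \<nu> * qeval (psi \<nu>) (fermat_sum p)))"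
proof -
  define q where "q a = fermat_quotient p (int a)" for a
  define y where "y \<nu> = qeval (psi \<nu>) (fermat_sum p)" for \<nu>
  define S where "S = (\<Sum>\<nu>=1..n. of_nat p ^ \<nu> / fact \<nu> * y \<nu>)"
  define E where "E = (\<Prod>a=1..p-1. [:1, q a:])"
  define G where "G = binomial_poly n y"
  have fs: "fermat_sum p = (\<lambda>k. \<Sum>a=1..p-1. q a ^ k)"
    by (simp add: fermat_sum_def q_def fun_eq_iff)
  have p1: "p \<ge> 1" using p prime_ge_1_nat by blast
  have q: "p_integral p (q a)" if "a \<in> {1..p-1}" for a
    unfolding q_def using p_integral_fermat_quotient[OF that] .
  have y: "p_integral p (y \<nu>)" for \<nu>
    unfolding y_def fs by (rule p_integral_qeval[OF int_qpoly_psi]) (auto intro!: p_integral_sum p_integral_power q)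
  have S_poly: "S = poly (egf_poly n y) (of_nat p)"
    by (simp add: S_def egf_poly_def poly_sum poly_monom mult.commute)
  have S1: "p_multiple p 1 S"
    unfolding S_poly
    by (rule p_multiple_poly)
       (use assms(2) y p_integral_of_int[of 0] in \<open>auto simp: coeff_egf_poly intro!: p_integral_divide_fact\<close>)

  \<comment> \<open>G and E agree up to degree n and have coefficients integral at p, so at t = p
    their difference is divisible by p^(n+1).\<close>
  have "p_multiple p (n + 1) (poly (G - E) (of_nat p))"
  proof (rule p_multiple_poly)
    fix i
    have "p_integral p (poly.coeff E i)"
      unfolding E_def
      by (rule p_integral_coeff_prod)
         (use q p_integral_of_int[of 0] p_integral_of_int[of 1] in \<open>auto simp: coeff_pCons split: nat.splits\<close>)
    then show "p_integral p (poly.coeff (G - E) i)"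
      unfolding G_def coeff_diff
      by (intro p_integral_diff p_integral_coeff_binomial_poly) (use assms y in auto)
  next
    fix i assume "i < n + 1"
    then show "poly.coeff (G - E) i = 0"
      using coeff_binomial_poly_psi[of "{1..p-1}" i n q] by (simp add: G_def E_def y_def[abs_def] fs)
  qed
  moreover have "poly E (of_nat p) = (1 - of_nat p * wilson_quotient p) ^ (p - 1)"
    unfolding prod_fermat_quotients[OF assms(1), symmetric] by (simp add: E_def poly_prod q_def)
  \<comment> \<open>At t = p the series is the binomial expansion of (1-S)^(p-1) cut off after \<nu>
    = n; the missing terms contain S^\<nu> with \<nu> > n, and p divides S.\<close>
  moreover have "p_multiple p (n + 1) ((1 - S) ^ (p - 1) - poly G (of_nat p))"
  proof -
    define t where "t \<nu> = of_nat ((p - 1) choose \<nu>) * (- S) ^ \<nu>" for \<nu>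
    have "poly G (of_nat p) = (\<Sum>\<nu>\<le>n. t \<nu>)"
      by (auto simp: G_def binomial_poly_def poly_sum poly_falling_poly[OF p1] S_poly t_def
          power_minus[of "poly _ _"] intro!: sum.cong)
    moreover have "(1 - S) ^ (p - 1) = (\<Sum>\<nu>\<le>p - 1. t \<nu>)"
      using binomial_ring[of "- S" 1 "p - 1"] by (simp add: t_def)
    moreover have "(\<Sum>\<nu>\<le>p - 1. t \<nu>) - (\<Sum>\<nu>\<le>n. t \<nu>) = (\<Sum>\<nu>\<in>{..p - 1} - {..n}. t \<nu>)"
      using assms(2) by (subst sum_diff) auto
    moreover have "p_multiple p (n + 1) (t \<nu>)" if "\<nu> \<in> {..p - 1} - {..n}" for \<nu>
    proof -
      have "p_multiple p (n + 1) ((- S) ^ \<nu>)"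
        using that by (intro p_multiple_power p_multiple_uminus S1) auto
      then show ?thesis
        unfolding t_def using p_integral_of_int[of "int ((p - 1) choose \<nu>)"]
        by (subst mult.commute) (auto intro: p_multiple_mult)
    qed
    ultimately show ?thesis by (simp only: p_multiple_sum)
  qed
  ultimately have "p_multiple p (n + 1) ((1 - S) ^ (p - 1) - (1 - of_nat p * wilson_quotient p) ^ (p - 1))"
    using p_multiple_add by fastforce
  \<comment> \<open>Both S and p W_p are divisible by p, as the cancellation requires.\<close>
  then have "p_multiple p (n + 1) (S - of_nat p * wilson_quotient p)"
    using p_multiple_power_mult[OF p_integral_wilson_quotient, of 1 1]
    by (intro p_multiple_cancel_power[OF S1]) auto
  then show ?thesis
    using p_multiple_uminus[of "n + 1" "S - of_nat p * wilson_quotient p"]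
    unfolding S_def y_def by simp
qed

end

theorem theorem1p1:
  shows "(\<forall>\<nu>\<ge>1.
            (\<forall>m. Poly_Mapping.lookup (psi \<nu>) m \<in> \<int>) \<and>
            (\<forall>m\<in>Poly_Mapping.keys (psi \<nu>). Poly_Mapping.keys m \<subseteq> {1..\<nu>}) \<and>
            Poly_Mapping.lookup (psi \<nu>) 0 = 0) \<and>
         (\<forall>n\<ge>1. \<forall>p. prime p \<and> odd p \<and> p > n \<longrightarrow>
            rat_cong p n (wilson_quotient p)
              (\<Sum>\<nu>=1..n. of_nat p ^ (\<nu> - 1) / fact \<nu> * qeval (psi \<nu>) (fermat_sum p)) \<and>
            rat_cong p (n + 1) (fact (p - 1))
              (- 1 + (\<Sum>\<nu>=1..n. of_nat p ^ \<nu> / fact \<nu> * qeval (psi \<nu>) (fermat_sum p))))"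
proof (intro conjI allI impI; (elim conjE)?)
  fix \<nu> m
  show "Poly_Mapping.lookup (psi \<nu>) m \<in> \<int>"
    using int_qpoly_psi by (simp add: int_qpoly_def)
next
  fix \<nu>
  show "\<forall>m\<in>Poly_Mapping.keys (psi \<nu>). Poly_Mapping.keys m \<subseteq> {1..\<nu>}"
    using int_qpoly_psi by (simp add: int_qpoly_def)
  show "Poly_Mapping.lookup (psi \<nu>) 0 = 0"
    by (simp add: lookup_0_eq_qeval psi_const_term)
next
  fix n p :: nat
  assume p: "prime p" "odd p" "n < p"
  define y where "y \<nu> = qeval (psi \<nu>) (fermat_sum p)" for \<nu>
  define S where "S = (\<Sum>\<nu>=1..n. of_nat p ^ \<nu> / fact \<nu> * y \<nu>)"
  define T where "T = (\<Sum>\<nu>=1..n. of_nat p ^ (\<nu> - 1) / fact \<nu> * y \<nu>)"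
  have p0: "p > 0" using p prime_gt_0_nat by blast
  have "p_integral p (fermat_sum p k)" for k
    unfolding fermat_sum_def using p
    by (intro p_integral_sum p_integral_power p_integral_fermat_quotient)
  then have "p_integral p (y \<nu>)" for \<nu>
    unfolding y_def using p by (intro p_integral_qeval[OF _ int_qpoly_psi])
  then have "p_integral p (of_nat p ^ k * y \<nu> / fact \<nu>)" if "\<nu> \<le> n" for k \<nu>
    using that p p_integral_of_int[OF p(1), of "int p"]
    by (intro p_integral_divide_fact p_integral_mult p_integral_power) auto
  then have ST: "p_integral p S" "p_integral p T"
    unfolding S_def T_def using p(1) by (auto intro!: p_integral_sum)
  \<comment> \<open>Dividing the congruence modulo p^(n+1) by p gives the one modulo p^n.\<close>
  have S_T: "S = of_nat p * T"
    unfolding S_def T_def sum_distrib_left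
    by (rule sum.cong) (auto simp flip: mult.assoc power_Suc)
  obtain c where c: "p_integral p c" "of_nat p * wilson_quotient p - S = of_nat p ^ (n + 1) * c"
    using p_multiple_wilson_psi[OF p] p(1) unfolding p_multiple_def S_def y_def by blast
  have "wilson_quotient p - T = of_nat p ^ n * c"
    using c(2) p0 by (simp add: S_T flip: right_diff_distrib)
  then show "rat_cong p n (wilson_quotient p)
      (\<Sum>\<nu>=1..n. of_nat p ^ (\<nu> - 1) / fact \<nu> * qeval (psi \<nu>) (fermat_sum p))"
    using c(1) ST p_integral_wilson_quotient[OF p(1)]
    unfolding rat_cong_def T_def y_def by blast
  \<comment> \<open>The same witness serves, since p W_p = (p-1)! + 1.\<close>
  have "fact (p - 1) - (- 1 + S) = of_nat p ^ (n + 1) * c"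
    unfolding c(2)[symmetric] using p0 by (simp add: wilson_quotient_def)
  moreover have "p_integral p (- 1 + S)" "p_integral p (fact (p - 1))"
    using p_integral_of_int[OF p(1), of "-1"] p_integral_of_int[OF p(1), of "fact (p - 1)"] ST p(1)
    using p_integral_add[OF p(1), of "- 1" S] by simp_all
  ultimately show "rat_cong p (n + 1) (fact (p - 1))
      (- 1 + (\<Sum>\<nu>=1..n. of_nat p ^ \<nu> / fact \<nu> * qeval (psi \<nu>) (fermat_sum p)))"
    using c(1) unfolding rat_cong_def S_def y_def by blast
qed

end
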